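(* Let $G$ be a locally compact group and let $H$ be a $\ast$-regular closed subgroup of $G$. If the closed two-sided ideal $I$ of $C^{\ast}(G)$ is induced from $H$, then $I$ is $L^1(G)$-determined.
   Context: All ideals are two-sided and closed in the respective norm. $C^{\ast}(G)$ is the full group $C^{\ast}$-algebra (the enveloping $C^{\ast}$-algebra of $L^1(G)$), and $L^1(G)$ is regarded as a subalgebra of it. $L^1(G)$-determined: a closed ideal $I$ of $C^{\ast}(G)$ is called $L^1(G)$-determined if for every closed ideal $J$ of $C^{\ast}(G)$ the inclusion $I\cap L^1(G)\subset J\cap L^1(G)$ implies $I\subset J$ (equivalently: the same implication with $J$ ranging over primitive ideals only; equivalently: $I\cap L^1(G)$ is dense in $I$ in the $C^{\ast}$-norm). $\ast$-regular: a locally compact group $H$ is $\ast$-regular if every closed ideal of $C^{\ast}(H)$ is $L^1(H)$-determined. Induced ideals: if $H$ is a closed subgroup of $G$, then $\mathcal{C}_0(H)$ (continuous functions with compact support) acts on $\mathcal{C}_0(G)$ by convolution from the left, $(a\ast f)(x)=\int_H a(h)f(h^{-1}x)\,dh$, and from the right, $(f\ast a)(x)=\int_H f(xh)\,\Delta_{G,H}(h^{-1})\,a(h^{-1})\,dh$ with $\Delta_{G,H}(h)=\Delta_H(h)\Delta_G(h)^{-1}$; these actions extend to actions of $C^{\ast}(H)$ on $C^{\ast}(G)$ as double centralizers (multipliers). For a closed ideal $J$ of $C^{\ast}(H)$, $\operatorname{ind}_H^G(J)$ is the closed linear span $(C^{\ast}(G)\ast J\ast C^{\ast}(G))^{-}$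 in $C^{\ast}(G)$. A closed ideal $I$ of $C^{\ast}(G)$ is said to be induced from $H$ if $I=\operatorname{ind}_H^G(J)$ for some closed ideal $J$ of $C^{\ast}(H)$. *)

theory Defs
  imports "HOL-Analysis.Analysis" "HOL-Algebra.Coset"
begin

section \<open>C*-algebras\<close>

class cstar_algebra = banach + real_normed_algebra +
  fixes scaleC :: "complex \<Rightarrow> 'a \<Rightarrow> 'a"
    and star :: "'a \<Rightarrow> 'a"
  assumes scaleC_add_right: "scaleC c (x + y) = scaleC c x + scaleC c y"
    and scaleC_add_left: "scaleC (c + d) x = scaleC c x + scaleC d x"
    and scaleC_scaleC: "scaleC c (scaleC d x) = scaleC (c * d) x"
    and scaleC_of_real: "scaleC (complex_of_real r) x = r *\<^sub>R x"
    and norm_scaleC: "norm (scaleC c x) = cmod c * norm x"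
    and mult_scaleC_left: "scaleC c x * y = scaleC c (x * y)"
    and mult_scaleC_right: "x * scaleC c y = scaleC c (x * y)"
    and star_add: "star (x + y) = star x + star y"
    and star_scaleC: "star (scaleC c x) = scaleC (cnj c) (star x)"
    and star_mult: "star (x * y) = star y * star x"
    and star_star: "star (star x) = x"
    and cstar_identity: "norm (star x * x) = (norm x)\<^sup>2"

global_interpretation complex_vector:
  vector_space "scaleC :: complex \<Rightarrow> 'a \<Rightarrow> 'a :: cstar_algebra"
  defines csubspace = "complex_vector.subspace" and cspan = "complex_vector.span"
  using scaleC_of_real[of 1]
  by unfold_locales (simp_all add: scaleC_add_right scaleC_add_left scaleC_scaleC)

definition closed_ideal :: "'a::cstar_algebra set \<Rightarrow> bool" where
  "closed_ideal I \<longleftrightarrow> closed I \<and> csubspace I \<and> (\<forall>a. \<forall>x\<in>I. a * x \<in> I \<and> x * a \<in> I)"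

definition double_centralizer ::
    "('a::cstar_algebra \<Rightarrow> 'a) \<Rightarrow> ('a \<Rightarrow> 'a) \<Rightarrow> bool" where
  "double_centralizer L R \<longleftrightarrow>
     Vector_Spaces.linear scaleC scaleC L \<and> Vector_Spaces.linear scaleC scaleC R \<and>
     (\<forall>x y. L (x * y) = L x * y \<and> R (x * y) = x * R y \<and> x * L y = R x * y)"

text \<open>
  A *-homomorphism from \<open>B\<close> into the multiplier algebra of \<open>A\<close>: \<open>L b x\<close> stands for \<open>b * x\<close> and
  \<open>R b x\<close> for \<open>x * b\<close>. The two norm bounds hold automatically for such a *-homomorphism.
\<close>
definition multiplier_action ::
    "('b::cstar_algebra \<Rightarrow> 'a::cstar_algebra \<Rightarrow> 'a) \<Rightarrow> ('b \<Rightarrow> 'a \<Rightarrow> 'a) \<Rightarrow> bool" where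
  "multiplier_action L R \<longleftrightarrow>
     (\<forall>b. double_centralizer (L b) (R b)) \<and>
     (\<forall>b c x. L (b + c) x = L b x + L c x \<and> R (b + c) x = R b x + R c x) \<and>
     (\<forall>k b x. L (scaleC k b) x = scaleC k (L b x) \<and> R (scaleC k b) x = scaleC k (R b x)) \<and>
     (\<forall>b c x. L (b * c) x = L b (L c x) \<and> R (b * c) x = R c (R b x)) \<and>
     (\<forall>b x. L (star b) x = star (R b (star x)) \<and> R (star b) x = star (L b (star x))) \<and>
     (\<forall>b x. norm (L b x) \<le> norm b * norm x \<and> norm (R b x) \<le> norm b * norm x)"


section \<open>Locally compact groups and Haar measure\<close>

locale locally_compact_group = group G for G (structure) +
  fixes T
  assumes topspace_eq: "topspace T = carrier G"
    and continuous_mult: "continuous_map (prod_topology T T) T (\<lambda>(x, y). x \<otimes> y)"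
    and continuous_inv: "continuous_map T T (\<lambda>x. inv x)"
    and hausdorff: "Hausdorff_space T"
    and locally_compact: "locally_compact_space T"

text \<open>
  Radon measure in the sense of outer regularity on all Borel sets and inner regularity on open
  sets; no \<open>\<sigma>\<close>-compactness of the group is assumed.
\<close>
definition left_haar_measure ::
    "('a, 'm) monoid_scheme \<Rightarrow> 'a topology \<Rightarrow> 'a measure \<Rightarrow> bool" where
  "left_haar_measure G T \<mu> \<longleftrightarrow>
     space \<mu> = topspace T \<and>
     sets \<mu> = sigma_sets (topspace T) {U. openin T U} \<and>
     emeasure \<mu> (space \<mu>) \<noteq> 0 \<and>
     (\<forall>K. compactin T K \<longrightarrow> emeasure \<mu> K < \<infinity>) \<and>
     (\<forall>A\<in>sets \<mu>. emeasure \<mu> A = (INF U\<in>{U. openin T U \<and> A \<subseteq> U}. emeasure \<mu> U)) \<and>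
     (\<forall>U. openin T U \<longrightarrow> emeasure \<mu> U = (SUP K\<in>{K. compactin T K \<and> K \<subseteq> U}. emeasure \<mu> K)) \<and>
     (\<forall>g\<in>carrier G. \<forall>A\<in>sets \<mu>. emeasure \<mu> (g <#\<^bsub>G\<^esub> A) = emeasure \<mu> A)"

text \<open>Convention: \<open>\<mu> (A x) = \<Delta>(x) \<mu> (A)\<close> for the left Haar measure \<open>\<mu>\<close>.\<close>
definition modular_function :: "('a, 'm) monoid_scheme \<Rightarrow> 'a measure \<Rightarrow> 'a \<Rightarrow> real" where
  "modular_function G \<mu> x =
     (THE c. 0 < c \<and> (\<forall>A\<in>sets \<mu>. emeasure \<mu> (A #>\<^bsub>G\<^esub> x) = ennreal c * emeasure \<mu> A))"

text \<open>Only the values on \<open>topspace T\<close> matter.\<close>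
definition compactly_supported :: "'a topology \<Rightarrow> ('a \<Rightarrow> complex) set" where
  "compactly_supported T =
     {f. continuous_map T euclidean f \<and>
         (\<exists>K. compactin T K \<and> (\<forall>x\<in>topspace T - K. f x = 0))}"


section \<open>The group algebra and its enveloping C*-algebra\<close>

text \<open>
  Elements of \<open>L\<^sup>1\<close> are represented by integrable functions; all maps out of it considered below
  identify functions that agree almost everywhere.
\<close>
definition L1 :: "'a measure \<Rightarrow> ('a \<Rightarrow> complex) set" where
  "L1 \<mu> = {f. integrable \<mu> f}"

definition L1_conv ::
    "('a, 'm) monoid_scheme \<Rightarrow> 'a measure \<Rightarrow> ('a \<Rightarrow> complex) \<Rightarrow> ('a \<Rightarrow> complex) \<Rightarrow> 'a \<Rightarrow> complex" where
  "L1_conv G \<mu> f g x = (\<integral>y. f y * g (inv\<^bsub>G\<^esub> y \<otimes>\<^bsub>G\<^esub> x) \<partial>\<mu>)"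

definition L1_star ::
    "('a, 'm) monoid_scheme \<Rightarrow> 'a measure \<Rightarrow> ('a \<Rightarrow> complex) \<Rightarrow> 'a \<Rightarrow> complex" where
  "L1_star G \<mu> f x = complex_of_real (modular_function G \<mu> (inv\<^bsub>G\<^esub> x)) * cnj (f (inv\<^bsub>G\<^esub> x))"

text \<open>
  Contractivity is automatic for a *-homomorphism of a Banach *-algebra into a C*-algebra; it
  makes \<open>\<iota>\<close> well defined on almost-everywhere classes.
\<close>
definition L1_star_hom ::
    "('a, 'm) monoid_scheme \<Rightarrow> 'a measure \<Rightarrow> (('a \<Rightarrow> complex) \<Rightarrow> 'c::cstar_algebra) \<Rightarrow> bool" where
  "L1_star_hom G \<mu> \<iota> \<longleftrightarrow>
     (\<forall>f\<in>L1 \<mu>. \<forall>g\<in>L1 \<mu>. \<iota> (\<lambda>x. f x + g x) = \<iota> f + \<iota> g \<and> \<iota> (L1_conv G \<mu> f g) = \<iota> f * \<iota> g) \<and>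
     (\<forall>f\<in>L1 \<mu>. \<forall>c. \<iota> (\<lambda>x. c * f x) = scaleC c (\<iota> f)) \<and>
     (\<forall>f\<in>L1 \<mu>. \<iota> (L1_star G \<mu> f) = star (\<iota> f)) \<and>
     (\<forall>f\<in>L1 \<mu>. norm (\<iota> f) \<le> (\<integral>x. cmod (f x) \<partial>\<mu>))"

text \<open>
  A null function \<open>f\<close> has \<open>f\<^sup>* * f = 0\<close> everywhere on the group, so compatibility with equality
  almost everywhere need not be required.
\<close>
definition L1_cstar_seminorm ::
    "('a, 'm) monoid_scheme \<Rightarrow> 'a measure \<Rightarrow> (('a \<Rightarrow> complex) \<Rightarrow> real) \<Rightarrow> bool" where
  "L1_cstar_seminorm G \<mu> p \<longleftrightarrow>
     (\<forall>f\<in>L1 \<mu>. 0 \<le> p f) \<and>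
     (\<forall>f\<in>L1 \<mu>. \<forall>g\<in>L1 \<mu>. p (\<lambda>x. f x + g x) \<le> p f + p g \<and> p (L1_conv G \<mu> f g) \<le> p f * p g) \<and>
     (\<forall>f\<in>L1 \<mu>. \<forall>c. p (\<lambda>x. c * f x) = cmod c * p f) \<and>
     (\<forall>f\<in>L1 \<mu>. p (L1_conv G \<mu> (L1_star G \<mu> f) f) = (p f)\<^sup>2)"

text \<open>
  The type \<open>'c\<close> together with \<open>\<iota>\<close> is the enveloping C*-algebra \<open>C\<^sup>*(G)\<close> of \<open>L\<^sup>1(G)\<close>: the image of
  \<open>L\<^sup>1(G)\<close> is dense, and every *-homomorphism from \<open>L\<^sup>1(G)\<close> into a C*-algebra factors through \<open>\<iota>\<close>.
  HOL cannot quantify over the types of all target C*-algebras inside a formula. But the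
  functions \<open>\<lambda>f. norm (\<phi> f)\<close> with \<open>\<phi>\<close> a *-homomorphism into some C*-algebra (or a *-representation on
  a Hilbert space) are exactly the C*-seminorms on \<open>L\<^sup>1(G)\<close>, and \<open>\<phi>\<close> factors through \<open>\<iota>\<close> if and only
  if \<open>norm (\<phi> f) \<le> norm (\<iota> f)\<close> for all \<open>f\<close>. This determines \<open>('c, \<iota>)\<close> up to unique isomorphism:
  it is the Hausdorff completion of \<open>L\<^sup>1(G)\<close> for its largest C*-seminorm.
\<close>
definition enveloping_cstar ::
    "('a, 'm) monoid_scheme \<Rightarrow> 'a measure \<Rightarrow> (('a \<Rightarrow> complex) \<Rightarrow> 'c::cstar_algebra) \<Rightarrow> bool" where
  "enveloping_cstar G \<mu> \<iota> \<longleftrightarrow>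
     L1_star_hom G \<mu> \<iota> \<and>
     closure (\<iota> ` L1 \<mu>) = UNIV \<and>
     (\<forall>p. L1_cstar_seminorm G \<mu> p \<longrightarrow> (\<forall>f\<in>L1 \<mu>. p f \<le> norm (\<iota> f)))"


section \<open>Determined ideals, *-regularity and induced ideals\<close>

definition L1_determined ::
    "'a measure \<Rightarrow> (('a \<Rightarrow> complex) \<Rightarrow> 'c::cstar_algebra) \<Rightarrow> 'c set \<Rightarrow> bool" where
  "L1_determined \<mu> \<iota> I \<longleftrightarrow>
     (\<forall>J. closed_ideal J \<longrightarrow> I \<inter> \<iota> ` L1 \<mu> \<subseteq> J \<inter> \<iota> ` L1 \<mu> \<longrightarrow> I \<subseteq> J)"

definition star_regular ::
    "'a measure \<Rightarrow> (('a \<Rightarrow> complex) \<Rightarrow> 'c::cstar_algebra) \<Rightarrow> bool" where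
  "star_regular \<mu> \<iota> \<longleftrightarrow> (\<forall>I. closed_ideal I \<longrightarrow> L1_determined \<mu> \<iota> I)"

definition conv_left ::
    "('a, 'm) monoid_scheme \<Rightarrow> 'a measure \<Rightarrow> ('a \<Rightarrow> complex) \<Rightarrow> ('a \<Rightarrow> complex) \<Rightarrow> 'a \<Rightarrow> complex" where
  "conv_left G \<nu> a f x = (\<integral>h. a h * f (inv\<^bsub>G\<^esub> h \<otimes>\<^bsub>G\<^esub> x) \<partial>\<nu>)"

definition relative_modular ::
    "('a, 'm) monoid_scheme \<Rightarrow> 'a measure \<Rightarrow> 'a set \<Rightarrow> 'a measure \<Rightarrow> 'a \<Rightarrow> real" where
  "relative_modular G \<mu> H \<nu> h =
     modular_function (G\<lparr>carrier := H\<rparr>) \<nu> h / modular_function G \<mu> h"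

definition conv_right ::
    "('a, 'm) monoid_scheme \<Rightarrow> 'a measure \<Rightarrow> 'a set \<Rightarrow> 'a measure \<Rightarrow>
      ('a \<Rightarrow> complex) \<Rightarrow> ('a \<Rightarrow> complex) \<Rightarrow> 'a \<Rightarrow> complex" where
  "conv_right G \<mu> H \<nu> f a x =
     (\<integral>h. f (x \<otimes>\<^bsub>G\<^esub> h) * complex_of_real (relative_modular G \<mu> H \<nu> (inv\<^bsub>G\<^esub> h)) * a (inv\<^bsub>G\<^esub> h) \<partial>\<nu>)"

text \<open>
  \<open>(L, R)\<close> is the action of \<open>C\<^sup>*(H)\<close> on \<open>C\<^sup>*(G)\<close> by multipliers that extends convolution of
  compactly supported continuous functions. It is unique, because these functions are dense.
\<close>
definition convolution_action ::
    "('a, 'm) monoid_scheme \<Rightarrow> 'a topology \<Rightarrow> 'a measure \<Rightarrow> 'a set \<Rightarrow> 'a measure \<Rightarrow>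
      (('a \<Rightarrow> complex) \<Rightarrow> 'c::cstar_algebra) \<Rightarrow> (('a \<Rightarrow> complex) \<Rightarrow> 'd::cstar_algebra) \<Rightarrow>
      ('d \<Rightarrow> 'c \<Rightarrow> 'c) \<Rightarrow> ('d \<Rightarrow> 'c \<Rightarrow> 'c) \<Rightarrow> bool" where
  "convolution_action G T \<mu> H \<nu> \<iota>G \<iota>H L R \<longleftrightarrow>
     multiplier_action L R \<and>
     (\<forall>a\<in>compactly_supported (subtopology T H). \<forall>f\<in>compactly_supported T.
        L (\<iota>H a) (\<iota>G f) = \<iota>G (conv_left G \<nu> a f) \<and>
        R (\<iota>H a) (\<iota>G f) = \<iota>G (conv_right G \<mu> H \<nu> f a))"

text \<open>\<open>L\<close> is the left half of a multiplier action; \<open>x * L j y\<close> is the product \<open>x * j * y\<close>.\<close>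
definition induced_ideal ::
    "('d::cstar_algebra \<Rightarrow> 'c::cstar_algebra \<Rightarrow> 'c) \<Rightarrow> 'd set \<Rightarrow> 'c set" where
  "induced_ideal L J = closure (cspan {x * L j y |x j y. j \<in> J})"

definition is_induced ::
    "('d::cstar_algebra \<Rightarrow> 'c::cstar_algebra \<Rightarrow> 'c) \<Rightarrow> 'c set \<Rightarrow> bool" where
  "is_induced L I \<longleftrightarrow> (\<exists>J. closed_ideal J \<and> I = induced_ideal L J)"

end

theory Submission
  imports Defs
begin

text \<open>
  Restriction \<open>K \<mapsto> {b. \<forall>x y. x * b * y \<in> K}\<close> from ideals of \<open>C\<^sup>*(G)\<close> to ideals of \<open>C\<^sup>*(H)\<close> is right
  adjoint to induction, so for \<open>I\<close> induced from \<open>J\<close> the inclusion \<open>I \<subseteq> K\<close> says that \<open>J\<close> lies in the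
  restriction of \<open>K\<close>. As \<open>H\<close> is *-regular, it is enough to test this on \<open>a \<in> J \<inter> L\<^sup>1(H)\<close>. For
  \<open>f, g \<in> L\<^sup>1(G)\<close> the element \<open>f * a * g\<close> lies in \<open>I \<inter> L\<^sup>1(G)\<close>, hence in \<open>K\<close>, and density of \<open>L\<^sup>1(G)\<close> in
  \<open>C\<^sup>*(G)\<close> gives the claim. That \<open>f * a * g\<close> belongs to \<open>L\<^sup>1(G)\<close> follows from the case of compactly
  supported continuous functions by approximation and completeness of \<open>L\<^sup>1(G)\<close>.
\<close>

section \<open>Compactly supported continuous functions in \<open>L\<^sup>1\<close>\<close>

locale radon_space =
  fixes X :: "'a topology" and M :: "'a measure"
  assumes hausdorff: "Hausdorff_space X"
    and locally_compact: "locally_compact_space X"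
    and space_eq: "space M = topspace X"
    and sets_eq: "sets M = sigma_sets (topspace X) {U. openin X U}"
    and compact_finite: "compactin X K \<Longrightarrow> emeasure M K < \<infinity>"
    and outer_regular:
      "A \<in> sets M \<Longrightarrow> emeasure M A = (INF U\<in>{U. openin X U \<and> A \<subseteq> U}. emeasure M U)"
    and inner_regular:
      "openin X U \<Longrightarrow> emeasure M U = (SUP K\<in>{K. compactin X K \<and> K \<subseteq> U}. emeasure M K)"
begin

lemma open_sets: "openin X U \<Longrightarrow> U \<in> sets M"
  unfolding sets_eq by (auto intro: sigma_sets.Basic)

lemma closed_sets: "closedin X C \<Longrightarrow> C \<in> sets M"
  using open_sets[of "topspace X - C"] sets.compl_sets[of "topspace X - C" M]
  by (auto simp: space_eq closedin_def double_diff)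

lemma compact_sets: "compactin X K \<Longrightarrow> K \<in> sets M"
  using compactin_imp_closedin closed_sets hausdorff by blast

lemma measurable_into:
  assumes "f \<in> topspace X \<rightarrow> space N" "sets N = sigma_sets (space N) \<G>" "\<G> \<subseteq> Pow (space N)"
    and "\<And>U. U \<in> \<G> \<Longrightarrow> openin X {x \<in> topspace X. f x \<in> U}"
  shows "f \<in> measurable M N"
proof (rule measurable_sigma_sets[OF assms(2,3)])
  show "f \<in> space M \<rightarrow> space N" using assms(1) by (simp add: space_eq)
  fix U assume "U \<in> \<G>"
  moreover have "f -` U \<inter> space M = {x \<in> topspace X. f x \<in> U}" by (auto simp: space_eq)
  ultimately show "f -` U \<inter> space M \<in> sets M" using assms(4) open_sets by simp
qed

lemma continuous_map_borel_measurable: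
  fixes f :: "'a \<Rightarrow> 'b::topological_space"
  assumes "continuous_map X euclidean f"
  shows "f \<in> borel_measurable M"
  using assms
  by (intro measurable_into[where \<G> = "{U. open U}"])
     (auto simp: borel_def continuous_map_def)

lemma continuous_map_measurable:
  assumes "continuous_map X X f"
  shows "f \<in> measurable M M"
  using assms
  by (intro measurable_into[where \<G> = "{U. openin X U}"])
     (auto simp: space_eq sets_eq continuous_map_def dest: openin_subset)

lemma compactly_supported_bounded:
  assumes "f \<in> compactly_supported X"
  obtains B where "\<And>x. x \<in> topspace X \<Longrightarrow> norm (f x) \<le> B"
proof -
  from assms obtain K where f: "continuous_map X euclidean f" and K: "compactin X K"
    and z: "\<And>x. x \<in> topspace X - K \<Longrightarrow> f x = 0"
    by (auto simp: compactly_supported_def)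
  have "compactin euclidean (f ` K)" using image_compactin[OF K f] .
  then have "bounded (f ` K)" by (simp add: compact_imp_bounded)
  then obtain B where B: "\<And>x. x \<in> K \<Longrightarrow> norm (f x) \<le> B" unfolding bounded_iff by auto
  have "norm (f x) \<le> max B 0" if "x \<in> topspace X" for x
    using B z that by (cases "x \<in> K") (auto simp: le_max_iff_disj)
  then show thesis by (rule that)
qed

lemma bounded_integrable:
  fixes f :: "'a \<Rightarrow> 'b::{banach, second_countable_topology}"
  assumes "f \<in> borel_measurable M" "compactin X K" "\<And>x. x \<in> topspace X - K \<Longrightarrow> f x = 0"
    "\<And>x. x \<in> topspace X \<Longrightarrow> norm (f x) \<le> B"
  shows "integrable M f" "(\<integral>x. norm (f x) \<partial>M) \<le> B * measure M K"
proof -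
  have fin: "emeasure M K < \<infinity>" and K: "K \<in> sets M"
    using assms(2) compact_finite compact_sets by auto
  have i: "integrable M (\<lambda>x. B * indicator K x)"
    using fin K by (simp add: integrable_real_indicator)
  have le: "norm (f x) \<le> B * indicator K x" if "x \<in> space M" for x
    using assms(3,4)[of x] that by (auto simp: space_eq indicator_def)
  show f: "integrable M f"
    by (rule Bochner_Integration.integrable_bound[OF i assms(1)])
      (use le in \<open>force intro!: AE_I2\<close>)
  have "(\<integral>x. norm (f x) \<partial>M) \<le> (\<integral>x. B * indicator K x \<partial>M)"
    using f i le by (intro integral_mono) auto
  also have "\<dots> = B * measure M K"
    using K sets.sets_into_space[OF K] by (simp add: Int_absorb1)
  finally show "(\<integral>x. norm (f x) \<partial>M) \<le> B * measure M K" .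
qed

lemma compactly_supported_integrable:
  assumes "f \<in> compactly_supported X"
  shows "integrable M f"
proof -
  from assms obtain K where f: "continuous_map X euclidean f" and K: "compactin X K"
    and z: "\<And>x. x \<in> topspace X - K \<Longrightarrow> f x = 0"
    by (auto simp: compactly_supported_def)
  obtain B where "\<And>x. x \<in> topspace X \<Longrightarrow> norm (f x) \<le> B"
    using compactly_supported_bounded[OF assms] by blast
  then show ?thesis
    using bounded_integrable(1)[OF continuous_map_borel_measurable[OF f] K z] by blast
qed

lemma Urysohn_compact_open:
  assumes "compactin X K" "openin X U" "K \<subseteq> U"
  obtains f :: "'a \<Rightarrow> real" and C where "continuous_map X euclidean f" "compactin X C" "C \<subseteq> U"
    "\<And>x. x \<in> topspace X \<Longrightarrow> 0 \<le> f x \<and> f x \<le> 1" "\<And>x. x \<in> K \<Longrightarrow> f x = 1"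
    "\<And>x. x \<in> topspace X - C \<Longrightarrow> f x = 0"
proof -
  have reg: "regular_space X"
    using hausdorff locally_compact locally_compact_Hausdorff_imp_regular_space by blast
  then have creg: "completely_regular_space X"
    using locally_compact locally_compact_regular_imp_completely_regular_space by blast
  have "\<exists>V C. openin X V \<and> compactin X C \<and> x \<in> V \<and> V \<subseteq> C \<and> C \<subseteq> U" if "x \<in> K" for x
    using locally_compact_regular_space_neighbourhood_base[of X] reg locally_compact assms that
    unfolding neighbourhood_base_of by (metis subsetD)
  then obtain V C where VC: "\<And>x. x \<in> K \<Longrightarrow> openin X (V x) \<and> compactin X (C x) \<and> x \<in> V x \<and> V x \<subseteq> C x \<and> C x \<subseteq> U"
    by metis
  obtain \<F> where "finite \<F>" "\<F> \<subseteq> V ` K" "K \<subseteq> \<Union>\<F>"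
    using compactinD[OF assms(1), of "V ` K"] VC by blast
  then obtain F where F: "finite F" "F \<subseteq> K" "K \<subseteq> \<Union>(V ` F)"
    by (metis finite_subset_image)
  let ?V = "\<Union>(V ` F)" and ?C = "\<Union>(C ` F)"
  have "compactin X ?C" using F VC by (intro compactin_Union) auto
  moreover have "?C \<subseteq> U" "?V \<subseteq> ?C" using F VC by blast+
  moreover have "closedin X (topspace X - ?V)" using F VC by (intro closedin_diff openin_Union) auto
  moreover have "disjnt K (topspace X - ?V)" using F by (auto simp: disjnt_iff)
  ultimately obtain f :: "'a \<Rightarrow> real" where f: "continuous_map X (subtopology euclidean {0..1}) f"
    "f ` (topspace X - ?V) \<subseteq> {0}" "f ` K \<subseteq> {1}"
    using Urysohn_completely_regular_compact_closed[OF _ creg assms(1), of 0 1 "topspace X - ?V"]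
    by (metis zero_le_one)
  show thesis
  proof
    show "continuous_map X euclidean f" using f(1) continuous_map_into_fulltopology by blast
    show "0 \<le> f x \<and> f x \<le> 1" if "x \<in> topspace X" for x
      using f(1) that by (auto simp: continuous_map_in_subtopology Pi_iff)
    show "f x = 0" if "x \<in> topspace X - ?C" for x using f(2) that \<open>?V \<subseteq> ?C\<close> by blast
  qed (use f \<open>compactin X ?C\<close> \<open>?C \<subseteq> U\<close> in auto)
qed

lemma indicator_approx:
  assumes A: "A \<in> sets M" "emeasure M A < \<infinity>" and e: "0 < (e::real)"
  shows "\<exists>f :: 'a \<Rightarrow> real. continuous_map X euclidean f \<and>
    (\<exists>K. compactin X K \<and> (\<forall>x\<in>topspace X - K. f x = 0)) \<and>
    integrable M f \<and> (\<integral>x. norm (indicator A x - f x) \<partial>M) \<le> e"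
proof -
  have "emeasure M A < emeasure M A + ennreal (e/2)"
    using A(2) e by (simp add: ennreal_add_left_cancel_less[where b=0, simplified])
  then obtain U where U: "openin X U" "A \<subseteq> U" "emeasure M U < emeasure M A + ennreal (e/2)"
    unfolding outer_regular[OF A(1)] INF_less_iff by blast
  have Us: "U \<in> sets M" and Ufin: "emeasure M U < \<infinity>"
    using U A(2) open_sets by (auto simp: less_top[symmetric] ennreal_add_eq_top dest: order.strict_trans)
  have mU: "measure M U < measure M A + e/2"
  proof -
    have "ennreal (measure M U) < ennreal (measure M A + e/2)"
      using U(3) Ufin A(2) e by (simp add: emeasure_eq_ennreal_measure less_top[symmetric])
    then show ?thesis using e by (simp add: ennreal_less_iff del: ennreal_plus)
  qed
  obtain K where K: "compactin X K" "K \<subseteq> U" "measure M U < measure M K + e/2"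
  proof (cases "emeasure M U = 0")
    case True
    then show thesis using that[of "{}"] e by (simp add: measure_def)
  next
    case False
    have "emeasure M U - ennreal (e/2) < emeasure M U"
      using False Ufin e by (intro ennreal_between) (auto simp: less_top[symmetric] zero_less_iff_neq_zero)
    then obtain K where K: "compactin X K" "K \<subseteq> U" "emeasure M U - ennreal (e/2) < emeasure M K"
      unfolding inner_regular[OF U(1)] less_SUP_iff by blast
    have "emeasure M K < \<infinity>" using K(1) compact_finite by blast
    then have "ennreal (measure M U - e/2) < ennreal (measure M K)"
      using K(3) Ufin e by (simp add: emeasure_eq_ennreal_measure less_top[symmetric] ennreal_minus)
    then have "measure M U - e/2 < measure M K"
      by (meson ennreal_leI leD leI)
    then show thesis using that[of K] K by simp
  qed
  obtain f :: "'a \<Rightarrow> real" and C where f: "continuous_map X euclidean f" "compactin X C" "C \<subseteq> U"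
    "\<And>x. x \<in> topspace X \<Longrightarrow> 0 \<le> f x \<and> f x \<le> 1" "\<And>x. x \<in> K \<Longrightarrow> f x = 1"
    "\<And>x. x \<in> topspace X - C \<Longrightarrow> f x = 0"
    using Urysohn_compact_open[OF K(1) U(1) K(2)] by blast
  have int: "integrable M f"
    using bounded_integrable(1)[OF continuous_map_borel_measurable[OF f(1)] f(2) f(6), of 1] f(4)
    by auto
  have Ks: "K \<in> sets M" "emeasure M K < \<infinity>" using K(1) compact_sets compact_finite by auto
  let ?g = "\<lambda>x. (indicator U x - indicator A x) + (indicator U x - indicator K x) :: real"
  have iU: "integrable M (indicator U :: 'a \<Rightarrow> real)" and iA: "integrable M (indicator A :: 'a \<Rightarrow> real)"
    and iK: "integrable M (indicator K :: 'a \<Rightarrow> real)"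
    using Us Ufin A Ks by (auto simp: integrable_real_indicator)
  have le: "norm (indicator A x - f x) \<le> ?g x" if "x \<in> space M" for x
  proof -
    have x: "x \<in> topspace X" using that by (simp add: space_eq)
    have "f x = 0" if "x \<notin> U" using that f(3,6) x by blast
    then show ?thesis
      using f(4)[OF x] f(5)[of x] U(2) K(2) by (auto simp: indicator_def)
  qed
  have "(\<integral>x. norm (indicator A x - f x) \<partial>M) \<le> (\<integral>x. ?g x \<partial>M)"
    using iU iA iK int le by (intro integral_mono) auto
  also have "\<dots> = (measure M U - measure M A) + (measure M U - measure M K)"
    using iU iA iK Us A(1) Ks(1) sets.sets_into_space by (simp add: Int_absorb2)
  also have "\<dots> \<le> e" using mU K(3) by simp
  finally show ?thesis using f(1,2,6) int by blast
qed

lemma compactly_supported_add: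
  assumes "f \<in> compactly_supported X" "g \<in> compactly_supported X"
  shows "(\<lambda>x. f x + g x) \<in> compactly_supported X"
proof -
  obtain K L where "compactin X K" "\<forall>x\<in>topspace X - K. f x = 0"
    "compactin X L" "\<forall>x\<in>topspace X - L. g x = 0"
    using assms by (auto simp: compactly_supported_def)
  then have "compactin X (K \<union> L)" "\<forall>x\<in>topspace X - (K \<union> L). f x + g x = 0"
    by (auto intro: compactin_Un)
  moreover have "continuous_map X euclidean (\<lambda>x. f x + g x)"
    using assms by (auto simp: compactly_supported_def intro: continuous_map_add)
  ultimately show ?thesis unfolding compactly_supported_def by blast
qed

lemma compactly_supported_mult:
  assumes "f \<in> compactly_supported X" "continuous_map X euclidean g"
  shows "(\<lambda>x. f x * g x) \<in> compactly_supported X"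
proof -
  obtain K where "compactin X K" "\<forall>x\<in>topspace X - K. f x * g x = 0"
    using assms by (auto simp: compactly_supported_def)
  moreover have "continuous_map X euclidean (\<lambda>x. f x * g x)"
    unfolding continuous_map_atin
    using assms by (auto simp: compactly_supported_def continuous_map_atin intro!: tendsto_mult)
  ultimately show ?thesis unfolding compactly_supported_def by blast
qed

lemma compactly_supported_diff:
  assumes "f \<in> compactly_supported X" "g \<in> compactly_supported X"
  shows "(\<lambda>x. f x - g x) \<in> compactly_supported X"
  using compactly_supported_add[OF assms(1) compactly_supported_mult[OF assms(2), of "\<lambda>_. -1"]]
  by simp

lemma compactly_supported_dense:
  fixes f :: "'a \<Rightarrow> complex"
  assumes "integrable M f" "0 < e"
  shows "\<exists>g \<in> compactly_supported X. (\<integral>x. norm (f x - g x) \<partial>M) \<le> e"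
  using assms
proof (induction f arbitrary: e rule: integrable_induct)
  case (base A c)
  obtain f :: "'a \<Rightarrow> real" and K where f: "continuous_map X euclidean f" "compactin X K"
    "\<forall>x\<in>topspace X - K. f x = 0" "integrable M f"
    "(\<integral>x. norm (indicator A x - f x) \<partial>M) \<le> e / (norm c + 1)"
    using indicator_approx[OF base(1,2), of "e / (norm c + 1)"] base(3)
    by (auto simp: add_nonneg_pos)
  have "continuous_map X euclidean (\<lambda>x. f x *\<^sub>R c)"
    using f(1) unfolding continuous_map_atin by (auto intro!: tendsto_scaleR)
  then have "(\<lambda>x. f x *\<^sub>R c) \<in> compactly_supported X"
    using f(2,3) unfolding compactly_supported_def by fastforce
  moreover have "(\<integral>x. norm (indicator A x *\<^sub>R c - f x *\<^sub>R c) \<partial>M) \<le> e"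
  proof -
    have "(\<integral>x. norm (indicator A x *\<^sub>R c - f x *\<^sub>R c) \<partial>M)
        = (\<integral>x. norm (indicator A x - f x) * norm c \<partial>M)"
      by (simp flip: scaleR_diff_left)
    also have "\<dots> = (\<integral>x. norm (indicator A x - f x) \<partial>M) * norm c"
      by simp
    also have "\<dots> \<le> e / (norm c + 1) * (norm c + 1)"
      using f(5) base(3) by (intro mult_mono) (auto simp: divide_nonneg_pos add_nonneg_pos)
    also have "\<dots> = e"
      by (metis add_nonneg_pos less_numeral_extra(1) nonzero_eq_divide_eq norm_ge_zero order_less_irrefl)
    finally show ?thesis .
  qed
  ultimately show ?case by (intro bexI[where x = "\<lambda>x. f x *\<^sub>R c"])
next
  case (add f g)
  obtain f' g' where f': "f' \<in> compactly_supported X" "(\<integral>x. norm (f x - f' x) \<partial>M) \<le> e/2"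
    and g': "g' \<in> compactly_supported X" "(\<integral>x. norm (g x - g' x) \<partial>M) \<le> e/2"
    using add.IH[of "e/2"] add.prems by (metis half_gt_zero)
  note i = compactly_supported_integrable[OF f'(1)] compactly_supported_integrable[OF g'(1)]
  have "(\<integral>x. norm ((f x + g x) - (f' x + g' x)) \<partial>M)
      \<le> (\<integral>x. norm (f x - f' x) + norm (g x - g' x) \<partial>M)"
    using i add.hyps by (intro integral_mono) (auto intro: norm_diff_triangle_ineq)
  also have "\<dots> \<le> e" using i add.hyps f' g' by simp
  finally show ?case
    using compactly_supported_add[OF f'(1) g'(1)] by (intro bexI[where x = "\<lambda>x. f' x + g' x"])
next
  case (lim f s)
  have "(\<lambda>i. \<integral>x. norm (f x - s i x) \<partial>M) \<longlonglongrightarrow> (\<integral>x. 0 \<partial>M)"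
  proof (rule integral_dominated_convergence[where w = "\<lambda>x. 3 * norm (f x)"])
    show "AE x in M. (\<lambda>i. norm (f x - s i x)) \<longlonglongrightarrow> 0"
    proof (rule AE_I2)
      fix x assume "x \<in> space M"
      then have "(\<lambda>i. f x - s i x) \<longlonglongrightarrow> f x - f x" by (intro tendsto_intros lim.hyps(2))
      then show "(\<lambda>i. norm (f x - s i x)) \<longlonglongrightarrow> 0" by (simp add: tendsto_norm_zero)
    qed
    show "AE x in M. norm (norm (f x - s i x)) \<le> 3 * norm (f x)" for i
      using lim.hyps(3)[of _ i] norm_triangle_ineq4[of "f _" "s i _"] by (intro AE_I2) (smt (verit, best) norm_ge_zero real_norm_def)
  qed (use lim.hyps(1,4) in auto)
  then have "(\<lambda>i. \<integral>x. norm (f x - s i x) \<partial>M) \<longlonglongrightarrow> 0" by simp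
  then obtain i where i: "(\<integral>x. norm (f x - s i x) \<partial>M) < e/2"
    using order_tendstoD(2)[of _ 0 sequentially "e/2"] lim.prems eventually_sequentially by force
  obtain g where g: "g \<in> compactly_supported X" "(\<integral>x. norm (s i x - g x) \<partial>M) \<le> e/2"
    using lim.IH[of "e/2" i] lim.prems by auto
  note ig = compactly_supported_integrable[OF g(1)]
  have "(\<integral>x. norm (f x - g x) \<partial>M) \<le> (\<integral>x. norm (f x - s i x) + norm (s i x - g x) \<partial>M)"
    using ig lim.hyps(1,4) by (intro integral_mono) (auto intro: norm_triangle_sub norm_diff_triangle_le)
  also have "\<dots> \<le> e" using i g ig lim.hyps(1,4) by simp
  finally show ?case using g(1) by blast
qed

end

lemma radon_space_haar:
  assumes "left_haar_measure G X M" "Hausdorff_space X" "locally_compact_space X"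
  shows "radon_space X M"
  using assms unfolding radon_space_def left_haar_measure_def Ball_def
  by (elim conjE, intro conjI) assumption+

lemma L1_fast_cauchy_limit:
  fixes c :: "nat \<Rightarrow> 'a \<Rightarrow> 'b::{banach, second_countable_topology}"
  assumes c: "\<And>n. integrable M (c n)"
    and s: "summable (\<lambda>n. \<integral>x. norm (c (Suc n) x - c n x) \<partial>M)"
  obtains F where "integrable M F" "(\<lambda>n. \<integral>x. norm (c n x - F x) \<partial>M) \<longlonglongrightarrow> 0"
proof -
  define d where "d n x = c (Suc n) x - c n x" for n x
  have d: "integrable M (d n)" for n using c by (simp add: d_def[abs_def])
  have [measurable]: "d n \<in> borel_measurable M" for n using d by auto
  have s': "summable (\<lambda>n. \<integral>x. norm (d n x) \<partial>M)" using s by (simp add: d_def)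
  have "(\<integral>\<^sup>+x. (\<Sum>n. ennreal (norm (d n x))) \<partial>M) = (\<Sum>n. \<integral>\<^sup>+x. norm (d n x) \<partial>M)"
    by (intro nn_integral_suminf) auto
  also have "\<dots> = (\<Sum>n. ennreal (\<integral>x. norm (d n x) \<partial>M))"
    by (intro arg_cong[where f=suminf] ext nn_integral_eq_integral integrable_norm d) auto
  also have "\<dots> \<noteq> \<infinity>" using s' by (simp add: ennreal_suminf_neq_top)
  finally have fin: "(\<integral>\<^sup>+x. (\<Sum>n. ennreal (norm (d n x))) \<partial>M) \<noteq> \<infinity>" .
  have ae: "AE x in M. summable (\<lambda>n. norm (d n x))"
    using nn_integral_PInf_AE[OF _ fin]
  proof (rule AE_mp)
    show "AE x in M. (\<Sum>n. ennreal (norm (d n x))) \<noteq> \<infinity> \<longrightarrow> summable (\<lambda>n. norm (d n x))"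
      by (intro AE_I2 impI summable_suminf_not_top) auto
  qed measurable
  have w: "integrable M (\<lambda>x. \<Sum>n. norm (d n x))"
    using d ae s' by (intro integrable_suminf) auto
  define F where "F x = c 0 x + (\<Sum>n. d n x)" for x
  have F: "integrable M F"
    using c d ae s' unfolding F_def[abs_def]
    by (intro Bochner_Integration.integrable_add integrable_suminf) auto
  have cs: "c n x = c 0 x + (\<Sum>i<n. d i x)" for n x
    by (induction n) (auto simp: d_def)
  have cF: "c n x - F x = (\<Sum>i<n. d i x) - (\<Sum>n. d n x)" for n x
    unfolding F_def by (subst cs) simp
  have "(\<lambda>n. \<integral>x. norm (c n x - F x) \<partial>M) \<longlonglongrightarrow> (\<integral>x. 0 \<partial>M)"
  proof (rule integral_dominated_convergence[where w = "\<lambda>x. 2 * (\<Sum>n. norm (d n x))"])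
    show "AE x in M. (\<lambda>n. norm (c n x - F x)) \<longlonglongrightarrow> 0"
      using ae
    proof eventually_elim
      case (elim x)
      then have "(\<lambda>n. \<Sum>i<n. d i x) \<longlonglongrightarrow> (\<Sum>n. d n x)"
        by (rule summable_LIMSEQ[OF summable_norm_cancel])
      then have "(\<lambda>n. (\<Sum>i<n. d i x) - (\<Sum>n. d n x)) \<longlonglongrightarrow> 0" by (rule LIM_zero)
      then show ?case unfolding cF by (rule tendsto_norm_zero)
    qed
    show "AE x in M. norm (norm (c n x - F x)) \<le> 2 * (\<Sum>n. norm (d n x))" for n
      using ae
    proof eventually_elim
      case (elim x)
      have "norm (\<Sum>n. d n x) \<le> (\<Sum>n. norm (d n x))" using elim by (rule summable_norm)
      moreover have "norm (\<Sum>i<n. d i x) \<le> (\<Sum>n. norm (d n x))"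
        using norm_sum[of "\<lambda>i. d i x" "{..<n}"] sum_le_suminf[OF elim, of "{..<n}"]
        by (meson finite_lessThan norm_ge_zero order_trans)
      moreover have "norm (c n x - F x) \<le> norm (\<Sum>i<n. d i x) + norm (\<Sum>n. d n x)"
        unfolding cF by (rule norm_triangle_ineq4)
      ultimately show ?case by simp
    qed
  qed (use c F w in auto)
  then show thesis using F that by simp
qed


section \<open>Convolution as a bounded map on \<open>L\<^sup>1\<close>\<close>

locale haar_convolution =
  locally_compact_group G T + G: radon_space T \<mu> + H: radon_space "subtopology T H" \<nu>
  for G :: "('a, 'm) monoid_scheme" (structure) and T and \<mu> and H and \<nu> +
  assumes subset: "H \<subseteq> carrier G"
    and left_invariant: "h \<in> carrier G \<Longrightarrow> A \<in> sets \<mu> \<Longrightarrow> emeasure \<mu> (h <#\<^bsub>G\<^esub> A) = emeasure \<mu> A"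
begin

lemma continuous_map_quotient: "continuous_map (prod_topology T T) T (\<lambda>(h, x). inv h \<otimes> x)"
proof -
  have "continuous_map (prod_topology T T) (prod_topology T T) (\<lambda>(h, x). (inv h, x))"
    unfolding case_prod_unfold continuous_map_pairwise o_def
    using continuous_map_compose[OF continuous_map_fst continuous_inv]
    by (simp add: continuous_map_snd o_def)
  from continuous_map_compose[OF this continuous_mult] show ?thesis
    by (simp add: o_def case_prod_unfold)
qed

lemma continuous_map_translate:
  assumes "h \<in> carrier G"
  shows "continuous_map T T (\<lambda>x. inv h \<otimes> x)"
proof -
  have "continuous_map T (prod_topology T T) (\<lambda>x. (h, x))"
    using assms by (simp add: continuous_map_pairwise o_def topspace_eq)
  from continuous_map_compose[OF this continuous_map_quotient] show ?thesis by (simp add: o_def)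
qed

lemma continuous_map_reflect:
  assumes "x \<in> carrier G"
  shows "continuous_map T T (\<lambda>h. inv h \<otimes> x)"
proof -
  have "continuous_map T (prod_topology T T) (\<lambda>h. (h, x))"
    using assms by (simp add: continuous_map_pairwise o_def topspace_eq)
  from continuous_map_compose[OF this continuous_map_quotient] show ?thesis by (simp add: o_def)
qed

lemma distr_translate:
  assumes h: "h \<in> carrier G"
  shows "distr \<mu> \<mu> (\<lambda>x. inv h \<otimes> x) = \<mu>"
proof (rule measure_eqI)
  have m: "(\<lambda>x. inv h \<otimes> x) \<in> measurable \<mu> \<mu>"
    using continuous_map_translate[OF h] by (rule G.continuous_map_measurable)
  fix A assume "A \<in> sets (distr \<mu> \<mu> (\<lambda>x. inv h \<otimes> x))"
  then have A: "A \<in> sets \<mu>" by simp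
  then have sub: "A \<subseteq> carrier G" using sets.sets_into_space[OF A] by (simp add: G.space_eq topspace_eq)
  have "(\<lambda>x. inv h \<otimes> x) -` A \<inter> space \<mu> = h <# A"
  proof (intro equalityI subsetI)
    fix x assume x: "x \<in> (\<lambda>x. inv h \<otimes> x) -` A \<inter> space \<mu>"
    then have "x = h \<otimes> (inv h \<otimes> x)"
      using h by (simp add: m_assoc[symmetric] G.space_eq topspace_eq)
    then show "x \<in> h <# A" using x by (auto simp: l_coset_def)
  next
    fix x assume "x \<in> h <# A"
    then obtain a where "a \<in> A" "x = h \<otimes> a" by (auto simp: l_coset_def)
    then show "x \<in> (\<lambda>x. inv h \<otimes> x) -` A \<inter> space \<mu>"
      using h sub by (auto simp: m_assoc[symmetric] G.space_eq topspace_eq subset_eq)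
  qed
  then show "emeasure (distr \<mu> \<mu> (\<lambda>x. inv h \<otimes> x)) A = emeasure \<mu> A"
    using A m left_invariant[OF h A] by (simp add: emeasure_distr)
qed simp

lemma
  fixes f :: "'a \<Rightarrow> 'b::{banach, second_countable_topology}"
  assumes h: "h \<in> carrier G" and f: "f \<in> borel_measurable \<mu>"
  shows integrable_translate: "integrable \<mu> (\<lambda>x. f (inv h \<otimes> x)) \<longleftrightarrow> integrable \<mu> f"
    and integral_translate: "(\<integral>x. f (inv h \<otimes> x) \<partial>\<mu>) = (\<integral>x. f x \<partial>\<mu>)"
proof -
  have m: "(\<lambda>x. inv h \<otimes> x) \<in> measurable \<mu> \<mu>"
    using continuous_map_translate[OF h] by (rule G.continuous_map_measurable)
  show "integrable \<mu> (\<lambda>x. f (inv h \<otimes> x)) \<longleftrightarrow> integrable \<mu> f"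
    using integrable_distr_eq[OF m f] by (simp add: distr_translate[OF h])
  show "(\<integral>x. f (inv h \<otimes> x) \<partial>\<mu>) = (\<integral>x. f x \<partial>\<mu>)"
    using integral_distr[OF m f] by (simp add: distr_translate[OF h])
qed

lemma conv_integrable:
  assumes a: "a \<in> compactly_supported (subtopology T H)" and g: "g \<in> compactly_supported T"
    and x: "x \<in> carrier G"
  shows "integrable \<nu> (\<lambda>h. a h * g (inv h \<otimes> x))"
proof -
  have "continuous_map T euclidean (\<lambda>h. g (inv h \<otimes> x))"
    using continuous_map_compose[OF continuous_map_reflect[OF x], of euclidean g] g
    by (simp add: o_def compactly_supported_def)
  then have "continuous_map (subtopology T H) euclidean (\<lambda>h. g (inv h \<otimes> x))"
    by (rule continuous_map_from_subtopology)
  with a show ?thesis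
    by (intro H.compactly_supported_integrable H.compactly_supported_mult)
qed

definition product_set :: "'a set \<Rightarrow> 'a set \<Rightarrow> 'a set"
  where "product_set K L = (\<lambda>(x, y). x \<otimes> y) ` (K \<times> L)"

lemma compactin_product_set:
  assumes "compactin T K" "compactin T L"
  shows "compactin T (product_set K L)"
  unfolding product_set_def
  using assms by (intro image_compactin[OF _ continuous_mult]) (simp add: compactin_Times)

lemma translate_zero:
  assumes "\<forall>x\<in>carrier G - L. g x = 0" "h \<in> K" "h \<in> carrier G"
    "x \<in> carrier G - product_set K L"
  shows "g (inv h \<otimes> x) = 0"
proof (rule bspec[OF assms(1)])
  have "x = h \<otimes> (inv h \<otimes> x)" using assms by (simp add: m_assoc[symmetric])
  then have "inv h \<otimes> x \<in> L \<Longrightarrow> x \<in> product_set K L"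
    using assms(2) unfolding product_set_def by (metis (mono_tags, lifting) SigmaI case_prod_conv image_eqI)
  then show "inv h \<otimes> x \<in> carrier G - L" using assms by auto
qed

lemma translate_uniformly_continuous:
  assumes g: "continuous_map T euclidean g" "\<forall>x\<in>carrier G - L. g x = (0::complex)"
    and K: "compactin T K" and L: "compactin T L" and h0: "h0 \<in> K" and e: "0 < e"
  shows "\<exists>U. openin T U \<and> h0 \<in> U \<and>
    (\<forall>h\<in>U \<inter> K. \<forall>x\<in>carrier G. norm (g (inv h \<otimes> x) - g (inv h0 \<otimes> x)) < e)"
proof -
  have K': "K \<subseteq> carrier G" using compactin_subset_topspace[OF K] by (simp add: topspace_eq)
  let ?P = "product_set K L"
  have P: "compactin T ?P" using compactin_product_set[OF K L] .
  define W where "W = {p \<in> topspace (prod_topology T T). g (inv (fst p) \<otimes> snd p) - g (inv h0 \<otimes> snd p) \<in> ball 0 e}"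
  have "continuous_map (prod_topology T T) euclidean (\<lambda>p. g (inv (fst p) \<otimes> snd p))"
    using continuous_map_compose[OF continuous_map_quotient g(1)]
    by (simp add: o_def case_prod_unfold)
  moreover have "continuous_map (prod_topology T T) euclidean (\<lambda>p. g (inv h0 \<otimes> snd p))"
    using continuous_map_compose[OF continuous_map_compose[OF continuous_map_snd continuous_map_translate] g(1), of h0] h0 K'
    by (auto simp: o_def)
  ultimately have "continuous_map (prod_topology T T) euclidean
      (\<lambda>p. g (inv (fst p) \<otimes> snd p) - g (inv h0 \<otimes> snd p))"
    by (rule continuous_map_diff)
  then have "openin (prod_topology T T) W"
    unfolding W_def by (rule openin_continuous_map_preimage) simp
  moreover have "{h0} \<times> ?P \<subseteq> W"
    using h0 K' e compactin_subset_topspace[OF P] by (auto simp: W_def topspace_eq)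
  ultimately obtain U V where UV: "openin T U" "h0 \<in> U" "?P \<subseteq> V" "U \<times> V \<subseteq> W"
    using tube_lemma_right[OF _ P, of T W h0] h0 K' by (auto simp: topspace_eq)
  have "norm (g (inv h \<otimes> x) - g (inv h0 \<otimes> x)) < e" if h: "h \<in> U \<inter> K" and x: "x \<in> carrier G" for h x
  proof (cases "x \<in> ?P")
    case True
    then have "(h, x) \<in> W" using UV h by blast
    then show ?thesis by (simp add: W_def)
  next
    case False
    then have "g (inv h \<otimes> x) = 0" "g (inv h0 \<otimes> x) = 0"
      using translate_zero[OF g(2), of _ K x] h x h0 K' by auto
    then show ?thesis using e by simp
  qed
  then show ?thesis using UV by blast
qed

text \<open>
  Riemann sums of translates stand in for Fubini's theorem, which is not available here because
  the measures need not be \<open>\<sigma>\<close>-finite.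
\<close>
lemma conv_left_Riemann_sum:
  assumes a: "a \<in> compactly_supported (subtopology T H)" and g: "g \<in> compactly_supported T"
  obtains C where "compactin T C" "\<And>e. 0 < e \<Longrightarrow> \<exists>s \<in> borel_measurable \<mu>.
      (\<forall>x\<in>topspace T - C. s x = 0 \<and> conv_left G \<nu> a g x = 0) \<and> integrable \<mu> s \<and>
      (\<integral>x. norm (s x) \<partial>\<mu>) \<le> (\<integral>h. norm (a h) \<partial>\<nu>) * (\<integral>x. norm (g x) \<partial>\<mu>) \<and>
      (\<forall>x\<in>topspace T. norm (conv_left G \<nu> a g x - s x) \<le> e * (\<integral>h. norm (a h) \<partial>\<nu>))"
proof -
  obtain L where gc: "continuous_map T euclidean g" and L: "compactin T L"
    and gL: "\<forall>x\<in>carrier G - L. g x = 0"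
    using g by (auto simp: compactly_supported_def topspace_eq)
  obtain K where K: "compactin T K" "K \<subseteq> H" and aK: "\<And>h. h \<in> H - K \<Longrightarrow> a h = 0"
    using a subset by (auto simp: compactly_supported_def compactin_subtopology topspace_eq Int_absorb1)
  have K': "K \<subseteq> carrier G" using K subset by blast
  have spH: "space \<nu> = H" using subset by (simp add: H.space_eq topspace_eq Int_absorb1)
  let ?P = "product_set K L"
  note ai = H.compactly_supported_integrable[OF a]
  note gi = G.compactly_supported_integrable[OF g]
  have gm: "g \<in> borel_measurable \<mu>" using gi by auto
  have zero: "a h * g (inv h \<otimes> x) = 0" if "h \<in> H" "x \<in> carrier G - ?P" for h x
    using aK[of h] translate_zero[OF gL, of h K x] that subset by (cases "h \<in> K") auto
  have sum: "\<exists>s \<in> borel_measurable \<mu>.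
      (\<forall>x\<in>topspace T - ?P. s x = 0 \<and> conv_left G \<nu> a g x = 0) \<and> integrable \<mu> s \<and>
      (\<integral>x. norm (s x) \<partial>\<mu>) \<le> (\<integral>h. norm (a h) \<partial>\<nu>) * (\<integral>x. norm (g x) \<partial>\<mu>) \<and>
      (\<forall>x\<in>topspace T. norm (conv_left G \<nu> a g x - s x) \<le> e * (\<integral>h. norm (a h) \<partial>\<nu>))"
    if e: "0 < e" for e
  proof -
    have "\<exists>U. openin T U \<and> k \<in> U \<and>
        (\<forall>h\<in>U \<inter> K. \<forall>x\<in>carrier G. norm (g (inv h \<otimes> x) - g (inv k \<otimes> x)) < e)" if "k \<in> K" for k
      using translate_uniformly_continuous[OF gc gL K(1) L that e] by blast
    then obtain U where U: "\<And>k. k \<in> K \<Longrightarrow> openin T (U k) \<and> k \<in> U k \<and>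
        (\<forall>h\<in>U k \<inter> K. \<forall>x\<in>carrier G. norm (g (inv h \<otimes> x) - g (inv k \<otimes> x)) < e)"
      by metis
    obtain \<F> where "finite \<F>" "\<F> \<subseteq> U ` K" "K \<subseteq> \<Union>\<F>"
      using compactinD[OF K(1), of "U ` K"] U by blast
    then obtain F where F: "finite F" "F \<subseteq> K" "K \<subseteq> \<Union>(U ` F)"
      by (metis finite_subset_image)
    obtain k :: "nat \<Rightarrow> 'a" and n where k: "F = k ` {0..<n}"
      using F(1) by (metis finite_imp_nat_seg_image_inj_on atLeast0LessThan lessThan_def)
    have kK: "k i \<in> K" if "i < n" for i using that F(2) k by auto
    define B where "B i = disjointed (\<lambda>i. U (k i)) i \<inter> K" for i
    have BK: "B i \<subseteq> K" "B i \<subseteq> U (k i)" for i using disjointed_subset by (fastforce simp: B_def)+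
    have KB: "K = (\<Union>i<n. B i)"
    proof -
      have "(\<Union>i<n. B i) = (\<Union>i\<in>{0..<n}. disjointed (\<lambda>i. U (k i)) i) \<inter> K"
        by (auto simp: B_def)
      also have "\<dots> = K" unfolding finite_UN_disjointed_eq using F(3) k by auto
      finally show ?thesis by simp
    qed
    have disj: "disjoint_family_on B {..<n}"
      using disjoint_family_disjointed[of "\<lambda>i. U (k i)"]
      by (auto simp: B_def disjoint_family_on_def)
    have Bs: "B i \<in> sets \<nu>" if "i < n" for i
    proof -
      have "U (k j) \<inter> H \<in> sets \<nu>" if "j < n" for j
        using U kK[OF that] by (intro H.open_sets) (auto simp: openin_subtopology)
      moreover have "K \<in> sets \<nu>" using K by (intro H.compact_sets) (simp add: compactin_subtopology)
      ultimately have "(U (k i) \<inter> H - (\<Union>j\<in>{0..<i}. U (k j) \<inter> H)) \<inter> K \<in> sets \<nu>"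
        using \<open>i < n\<close> by (intro sets.Int[of _ _ K] sets.Diff sets.finite_UN) auto
      also have "(U (k i) \<inter> H - (\<Union>j\<in>{0..<i}. U (k j) \<inter> H)) \<inter> K = B i"
        using K(2) by (auto simp: B_def disjointed_def)
      finally show ?thesis .
    qed
    have ind: "(\<Sum>i<n. indicator (B i) h) = (indicator K h :: real)" for h
      unfolding KB using disj by (subst indicator_UN_disjoint) auto
    have split: "(\<Sum>i<n. indicator (B i) h *\<^sub>R c h) = c h" if "h \<in> H" "h \<notin> K \<Longrightarrow> c h = 0"
      for c :: "'a \<Rightarrow> 'b::real_normed_vector" and h
      unfolding scaleR_left.sum[symmetric] ind using that by (auto simp: indicator_def)
    have aBi: "integrable \<nu> (\<lambda>h. indicator (B i) h *\<^sub>R a h)" if "i < n" for i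
      using Bs[OF that] ai by (intro integrable_mult_indicator)
    have nBi: "integrable \<nu> (\<lambda>h. indicator (B i) h *\<^sub>R norm (a h))" if "i < n" for i
      using Bs[OF that] ai by (intro integrable_mult_indicator integrable_norm)
    have nsum: "(\<Sum>i<n. \<integral>h. indicator (B i) h *\<^sub>R norm (a h) \<partial>\<nu>) = (\<integral>h. norm (a h) \<partial>\<nu>)"
    proof -
      have "(\<Sum>i<n. \<integral>h. indicator (B i) h *\<^sub>R norm (a h) \<partial>\<nu>)
          = (\<integral>h. (\<Sum>i<n. indicator (B i) h *\<^sub>R norm (a h)) \<partial>\<nu>)"
        using nBi by (subst Bochner_Integration.integral_sum) auto
      also have "\<dots> = (\<integral>h. norm (a h) \<partial>\<nu>)"
        using aK spH by (intro Bochner_Integration.integral_cong refl split) auto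
      finally show ?thesis .
    qed
    define c where "c i = (\<integral>h. indicator (B i) h *\<^sub>R a h \<partial>\<nu>)" for i
    define s where "s x = (\<Sum>i<n. c i * g (inv (k i) \<otimes> x))" for x
    have cn: "norm (c i) \<le> (\<integral>h. indicator (B i) h *\<^sub>R norm (a h) \<partial>\<nu>)" for i
      unfolding c_def by (rule order_trans[OF integral_norm_bound]) simp
    have kc: "k i \<in> carrier G" if "i < n" for i using kK[OF that] K' by blast
    have gti: "integrable \<mu> (\<lambda>x. g (inv (k i) \<otimes> x))" if "i < n" for i
      using integrable_translate[OF kc[OF that] gm] gi by simp
    have si: "integrable \<mu> s" unfolding s_def[abs_def] using gti by auto
    have "(\<integral>x. norm (s x) \<partial>\<mu>) \<le> (\<integral>x. (\<Sum>i<n. norm (c i) * norm (g (inv (k i) \<otimes> x))) \<partial>\<mu>)"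
    proof (rule integral_mono)
      show "norm (s x) \<le> (\<Sum>i<n. norm (c i) * norm (g (inv (k i) \<otimes> x)))" for x
        unfolding s_def by (rule order_trans[OF norm_sum]) (simp add: norm_mult)
    qed (use si gti in auto)
    also have "\<dots> = (\<Sum>i<n. norm (c i) * (\<integral>x. norm (g (inv (k i) \<otimes> x)) \<partial>\<mu>))"
      using gti by (subst Bochner_Integration.integral_sum) auto
    also have "\<dots> = (\<Sum>i<n. norm (c i) * (\<integral>x. norm (g x) \<partial>\<mu>))"
      using integral_translate[OF kc, of _ "\<lambda>x. norm (g x)"] gm by (intro sum.cong) auto
    also have "\<dots> = (\<Sum>i<n. norm (c i)) * (\<integral>x. norm (g x) \<partial>\<mu>)" by (rule sum_distrib_right[symmetric])
    also have "\<dots> \<le> (\<integral>h. norm (a h) \<partial>\<nu>) * (\<integral>x. norm (g x) \<partial>\<mu>)"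
      unfolding nsum[symmetric] by (intro mult_right_mono sum_mono cn) simp
    finally have sn: "(\<integral>x. norm (s x) \<partial>\<mu>) \<le> (\<integral>h. norm (a h) \<partial>\<nu>) * (\<integral>x. norm (g x) \<partial>\<mu>)" .
    have "s x = 0 \<and> conv_left G \<nu> a g x = 0" if "x \<in> topspace T - ?P" for x
    proof
      show "s x = 0" unfolding s_def
        using translate_zero[OF gL, of _ K x] kK kc that by (intro sum.neutral) (auto simp: topspace_eq)
      have "conv_left G \<nu> a g x = (\<integral>h. 0 \<partial>\<nu>)" unfolding conv_left_def
        using zero that spH by (intro Bochner_Integration.integral_cong refl) (auto simp: topspace_eq)
      then show "conv_left G \<nu> a g x = 0" by simp
    qed
    moreover have "norm (conv_left G \<nu> a g x - s x) \<le> e * (\<integral>h. norm (a h) \<partial>\<nu>)"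
      if "x \<in> topspace T" for x
    proof -
      have x: "x \<in> carrier G" using that by (simp add: topspace_eq)
      note ci = conv_integrable[OF a g x]
      have cBi: "integrable \<nu> (\<lambda>h. indicator (B i) h *\<^sub>R (a h * g (inv h \<otimes> x)))" if "i < n" for i
        using Bs[OF that] ci by (intro integrable_mult_indicator)
      have "conv_left G \<nu> a g x = (\<integral>h. (\<Sum>i<n. indicator (B i) h *\<^sub>R (a h * g (inv h \<otimes> x))) \<partial>\<nu>)"
        unfolding conv_left_def
        using aK spH by (intro Bochner_Integration.integral_cong refl split[symmetric]) auto
      also have "\<dots> = (\<Sum>i<n. \<integral>h. indicator (B i) h *\<^sub>R (a h * g (inv h \<otimes> x)) \<partial>\<nu>)"
        using cBi by (subst Bochner_Integration.integral_sum) auto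
      finally have "conv_left G \<nu> a g x - s x = (\<Sum>i<n. (\<integral>h. indicator (B i) h *\<^sub>R (a h * g (inv h \<otimes> x)) \<partial>\<nu>)
          - (\<integral>h. (indicator (B i) h *\<^sub>R a h) * g (inv (k i) \<otimes> x) \<partial>\<nu>))"
        by (simp add: s_def c_def sum_subtractf del: mult_scaleR_left)
      also have "norm \<dots> \<le> (\<Sum>i<n. e * (\<integral>h. indicator (B i) h *\<^sub>R norm (a h) \<partial>\<nu>))"
      proof (rule order_trans[OF norm_sum], rule sum_mono)
        fix i assume "i \<in> {..<n}"
        then have i: "i < n" by simp
        have ti: "integrable \<nu> (\<lambda>h. (indicator (B i) h *\<^sub>R a h) * g (inv (k i) \<otimes> x))"
          using aBi[OF i] by (rule integrable_mult_left)
        have "norm ((\<integral>h. indicator (B i) h *\<^sub>R (a h * g (inv h \<otimes> x)) \<partial>\<nu>)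
            - (\<integral>h. (indicator (B i) h *\<^sub>R a h) * g (inv (k i) \<otimes> x) \<partial>\<nu>))
          = norm (\<integral>h. indicator (B i) h *\<^sub>R (a h * g (inv h \<otimes> x)) - (indicator (B i) h *\<^sub>R a h) * g (inv (k i) \<otimes> x) \<partial>\<nu>)"
          using cBi[OF i] ti by simp
        also have "\<dots> \<le> (\<integral>h. norm (indicator (B i) h *\<^sub>R (a h * g (inv h \<otimes> x)) - (indicator (B i) h *\<^sub>R a h) * g (inv (k i) \<otimes> x)) \<partial>\<nu>)"
          by (rule integral_norm_bound)
        also have "\<dots> \<le> (\<integral>h. e * (indicator (B i) h *\<^sub>R norm (a h)) \<partial>\<nu>)"
        proof (rule integral_mono)
          fix h assume "h \<in> space \<nu>"
          show "norm (indicator (B i) h *\<^sub>R (a h * g (inv h \<otimes> x)) - (indicator (B i) h *\<^sub>R a h) * g (inv (k i) \<otimes> x))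
              \<le> e * (indicator (B i) h *\<^sub>R norm (a h))"
          proof (cases "h \<in> B i")
            case True
            then have "norm (g (inv h \<otimes> x) - g (inv (k i) \<otimes> x)) < e"
              using U[OF kK[OF i]] BK x by blast
            then have "norm (a h) * norm (g (inv h \<otimes> x) - g (inv (k i) \<otimes> x)) \<le> norm (a h) * e"
              by (intro mult_left_mono) auto
            then show ?thesis
              using True by (simp add: mult.commute flip: right_diff_distrib norm_mult)
          qed simp
        qed (use cBi[OF i] ti nBi[OF i] in auto)
        finally show "norm ((\<integral>h. indicator (B i) h *\<^sub>R (a h * g (inv h \<otimes> x)) \<partial>\<nu>)
            - (\<integral>h. (indicator (B i) h *\<^sub>R a h) * g (inv (k i) \<otimes> x) \<partial>\<nu>))
          \<le> e * (\<integral>h. indicator (B i) h *\<^sub>R norm (a h) \<partial>\<nu>)" by simp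
      qed
      also have "\<dots> = e * (\<integral>h. norm (a h) \<partial>\<nu>)"
        unfolding nsum[symmetric] by (rule sum_distrib_left[symmetric])
      finally show ?thesis .
    qed
    ultimately show ?thesis using si sn borel_measurable_integrable[OF si] by blast
  qed
  show thesis using that[OF compactin_product_set[OF K(1) L]] sum by blast
qed

lemma
  assumes a: "a \<in> compactly_supported (subtopology T H)" and g: "g \<in> compactly_supported T"
  shows integrable_conv_left: "integrable \<mu> (conv_left G \<nu> a g)"
    and norm_conv_left:
      "(\<integral>x. norm (conv_left G \<nu> a g x) \<partial>\<mu>) \<le> (\<integral>h. norm (a h) \<partial>\<nu>) * (\<integral>x. norm (g x) \<partial>\<mu>)"
proof -
  let ?A = "\<integral>h. norm (a h) \<partial>\<nu>"
  obtain C where C: "compactin T C" and s: "\<And>e. 0 < e \<Longrightarrow> \<exists>s \<in> borel_measurable \<mu>.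
      (\<forall>x\<in>topspace T - C. s x = 0 \<and> conv_left G \<nu> a g x = 0) \<and> integrable \<mu> s \<and>
      (\<integral>x. norm (s x) \<partial>\<mu>) \<le> ?A * (\<integral>x. norm (g x) \<partial>\<mu>) \<and>
      (\<forall>x\<in>topspace T. norm (conv_left G \<nu> a g x - s x) \<le> e * ?A)"
    using conv_left_Riemann_sum[OF a g] by blast
  then have "\<forall>n. \<exists>s. s \<in> borel_measurable \<mu> \<and>
      (\<forall>x\<in>topspace T. norm (conv_left G \<nu> a g x - s x) \<le> 1 / real (Suc n) * ?A)"
    by (metis of_nat_0_less_iff zero_less_Suc zero_less_divide_1_iff)
  then obtain S where S: "\<And>n. S n \<in> borel_measurable \<mu>"
    "\<And>n x. x \<in> topspace T \<Longrightarrow> norm (conv_left G \<nu> a g x - S n x) \<le> 1 / real (Suc n) * ?A"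
    by metis
  have cm: "conv_left G \<nu> a g \<in> borel_measurable \<mu>"
  proof (rule borel_measurable_LIMSEQ_metric[OF S(1)])
    fix x assume "x \<in> space \<mu>"
    then have x: "x \<in> topspace T" by (simp add: G.space_eq)
    have "(\<lambda>n. 1 / real (Suc n) * ?A) \<longlonglongrightarrow> 0 * ?A"
      by (rule tendsto_mult[OF LIMSEQ_Suc[OF lim_1_over_n] tendsto_const])
    then have lim0: "(\<lambda>n. 1 / real (Suc n) * ?A) \<longlonglongrightarrow> 0" by simp
    have "(\<lambda>n. conv_left G \<nu> a g x - S n x) \<longlonglongrightarrow> 0"
      by (rule Lim_null_comparison[OF always_eventually lim0]) (use S(2)[OF x] in blast)
    then have "(\<lambda>n. conv_left G \<nu> a g x - (conv_left G \<nu> a g x - S n x)) \<longlonglongrightarrow> conv_left G \<nu> a g x - 0"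
      by (intro tendsto_diff tendsto_const)
    then show "(\<lambda>n. S n x) \<longlonglongrightarrow> conv_left G \<nu> a g x" by simp
  qed
  have *: "integrable \<mu> (conv_left G \<nu> a g) \<and>
      (\<integral>x. norm (conv_left G \<nu> a g x) \<partial>\<mu>) \<le> ?A * (\<integral>x. norm (g x) \<partial>\<mu>) + e * (?A * measure \<mu> C)"
    if e: "0 < e" for e
  proof -
    obtain t where t: "t \<in> borel_measurable \<mu>" "integrable \<mu> t"
      "\<And>x. x \<in> topspace T - C \<Longrightarrow> t x = 0 \<and> conv_left G \<nu> a g x = 0"
      "(\<integral>x. norm (t x) \<partial>\<mu>) \<le> ?A * (\<integral>x. norm (g x) \<partial>\<mu>)"
      "\<And>x. x \<in> topspace T \<Longrightarrow> norm (conv_left G \<nu> a g x - t x) \<le> e * ?A"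
      using s[OF e] by blast
    let ?d = "\<lambda>x. conv_left G \<nu> a g x - t x"
    have dm: "?d \<in> borel_measurable \<mu>" using cm t(1) by measurable
    have dz: "?d x = 0" if "x \<in> topspace T - C" for x using t(3)[OF that] by simp
    note d = G.bounded_integrable[OF dm C dz t(5)]
    have i: "integrable \<mu> (conv_left G \<nu> a g)"
      using Bochner_Integration.integrable_add[OF d(1) t(2)] by simp
    have "(\<integral>x. norm (conv_left G \<nu> a g x) \<partial>\<mu>) \<le> (\<integral>x. norm (t x) + norm (?d x) \<partial>\<mu>)"
      using i d(1) t(2) by (intro integral_mono) (auto simp: norm_triangle_sub)
    also have "\<dots> = (\<integral>x. norm (t x) \<partial>\<mu>) + (\<integral>x. norm (?d x) \<partial>\<mu>)"
      using d(1) t(2) by (intro Bochner_Integration.integral_add) auto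
    also have "\<dots> \<le> ?A * (\<integral>x. norm (g x) \<partial>\<mu>) + e * (?A * measure \<mu> C)"
      using t(4) d(2) by (simp add: mult.assoc)
    finally show ?thesis using i by simp
  qed
  show "integrable \<mu> (conv_left G \<nu> a g)" using *[of 1] by simp
  show "(\<integral>x. norm (conv_left G \<nu> a g x) \<partial>\<mu>) \<le> ?A * (\<integral>x. norm (g x) \<partial>\<mu>)"
  proof (rule field_le_epsilon)
    fix e :: real assume e: "0 < e"
    let ?m = "?A * measure \<mu> C"
    have m: "0 \<le> ?m" by simp
    have "e / (?m + 1) * ?m \<le> e / (?m + 1) * (?m + 1)" using e m by (intro mult_left_mono) auto
    also have "\<dots> = e" using add_nonneg_pos[OF m zero_less_one] by simp
    finally show "(\<integral>x. norm (conv_left G \<nu> a g x) \<partial>\<mu>) \<le> ?A * (\<integral>x. norm (g x) \<partial>\<mu>) + e"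
      using *[of "e / (?m + 1)"] e m by (simp add: add_nonneg_pos)
  qed
qed

end

lemma scaleC_minus_one: "scaleC (-1) x = - (x :: 'c::cstar_algebra)"
  using scaleC_of_real[of "-1" x] by simp

lemma L1_star_hom_diff:
  assumes "L1_star_hom G \<mu> \<iota>" "f \<in> L1 \<mu>" "g \<in> L1 \<mu>"
  shows "\<iota> (\<lambda>x. f x - g x) = \<iota> f - \<iota> g"
proof -
  have "(\<lambda>x. -1 * g x) \<in> L1 \<mu>" using assms(3) by (simp add: L1_def)
  then have "\<iota> (\<lambda>x. f x + -1 * g x) = \<iota> f + scaleC (-1) (\<iota> g)"
    using assms unfolding L1_star_hom_def by metis
  then show ?thesis by (simp add: scaleC_minus_one)
qed

lemma L1_star_hom_norm_diff:
  assumes "L1_star_hom G \<mu> \<iota>" "f \<in> L1 \<mu>" "g \<in> L1 \<mu>"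
  shows "norm (\<iota> f - \<iota> g) \<le> (\<integral>x. norm (f x - g x) \<partial>\<mu>)"
proof -
  have "(\<lambda>x. f x - g x) \<in> L1 \<mu>" using assms(2,3) by (simp add: L1_def)
  then show ?thesis
    using assms(1) unfolding L1_star_hom_diff[OF assms, symmetric] L1_star_hom_def by blast
qed

lemma L1_star_hom_tendsto:
  assumes "L1_star_hom G \<mu> \<iota>" "\<And>n. f n \<in> L1 \<mu>" "g \<in> L1 \<mu>"
    and "(\<lambda>n. \<integral>x. norm (f n x - g x) \<partial>\<mu>) \<longlonglongrightarrow> 0"
  shows "(\<lambda>n. \<iota> (f n)) \<longlonglongrightarrow> \<iota> g"
proof (rule LIM_zero_cancel, rule Lim_null_comparison[OF always_eventually assms(4)], rule allI)
  show "norm (\<iota> (f n) - \<iota> g) \<le> (\<integral>x. norm (f n x - g x) \<partial>\<mu>)" for n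
    using L1_star_hom_norm_diff[OF assms(1,2,3)] .
qed

context radon_space
begin

lemma compactly_supported_fast_approx:
  assumes f: "f \<in> L1 M"
  obtains g where "\<And>n. g n \<in> compactly_supported X" "(\<lambda>n. \<integral>x. norm (g n x - f x) \<partial>M) \<longlonglongrightarrow> 0"
    "\<And>n. (\<integral>x. norm (g (Suc n) x - g n x) \<partial>M) \<le> 2 * (1/2)^n"
    "\<And>n. (\<integral>x. norm (g n x) \<partial>M) \<le> (\<integral>x. norm (f x) \<partial>M) + 1"
proof -
  have fi: "integrable M f" using f by (simp add: L1_def)
  have "\<forall>n. \<exists>g. g \<in> compactly_supported X \<and> (\<integral>x. norm (f x - g x) \<partial>M) \<le> (1/2)^n"
    using compactly_supported_dense[OF fi, of "(1/2)^n" for n] by auto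
  then obtain g where g: "\<And>n. g n \<in> compactly_supported X"
    "\<And>n. (\<integral>x. norm (f x - g n x) \<partial>M) \<le> (1/2)^n"
    by metis
  have gi: "integrable M (g n)" for n using compactly_supported_integrable[OF g(1)] .
  show thesis
  proof
    show "g n \<in> compactly_supported X" for n using g(1) .
    show "(\<lambda>n. \<integral>x. norm (g n x - f x) \<partial>M) \<longlonglongrightarrow> 0"
    proof (rule tendsto_sandwich[OF _ _ tendsto_const])
      show "(\<lambda>n. (1/2 :: real)^n) \<longlonglongrightarrow> 0" by (rule LIMSEQ_realpow_zero) auto
    qed (use g(2) in \<open>auto simp: norm_minus_commute\<close>)
    show "(\<integral>x. norm (g (Suc n) x - g n x) \<partial>M) \<le> 2 * (1/2)^n" for n
    proof -
      have "(\<integral>x. norm (g (Suc n) x - g n x) \<partial>M)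
          \<le> (\<integral>x. norm (f x - g (Suc n) x) + norm (f x - g n x) \<partial>M)"
      proof (rule integral_mono)
        fix x
        show "norm (g (Suc n) x - g n x) \<le> norm (f x - g (Suc n) x) + norm (f x - g n x)"
          using norm_triangle_ineq4[of "f x - g n x" "f x - g (Suc n) x"] by simp
      qed (use fi gi in auto)
      also have "\<dots> = (\<integral>x. norm (f x - g (Suc n) x) \<partial>M) + (\<integral>x. norm (f x - g n x) \<partial>M)"
        using fi gi by (intro Bochner_Integration.integral_add) auto
      also have "\<dots> \<le> (1/2)^Suc n + (1/2)^n" using g(2) by (intro add_mono)
      also have "\<dots> \<le> 2 * (1/2)^n" by simp
      finally show ?thesis .
    qed
    show "(\<integral>x. norm (g n x) \<partial>M) \<le> (\<integral>x. norm (f x) \<partial>M) + 1" for n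
    proof -
      have "(\<integral>x. norm (g n x) \<partial>M) \<le> (\<integral>x. norm (f x) + norm (f x - g n x) \<partial>M)"
      proof (rule integral_mono)
        fix x
        show "norm (g n x) \<le> norm (f x) + norm (f x - g n x)"
          using norm_triangle_ineq4[of "f x" "f x - g n x"] by simp
      qed (use fi gi in auto)
      also have "\<dots> = (\<integral>x. norm (f x) \<partial>M) + (\<integral>x. norm (f x - g n x) \<partial>M)"
        using fi gi by (intro Bochner_Integration.integral_add) auto
      also have "\<dots> \<le> (\<integral>x. norm (f x) \<partial>M) + 1"
        using g(2)[of n] power_le_one[of "1/2 :: real" n] by simp
      finally show ?thesis .
    qed
  qed
qed

end

context haar_convolution
begin

lemma conv_left_diff:
  assumes "a \<in> compactly_supported (subtopology T H)" "a' \<in> compactly_supported (subtopology T H)"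
    "g \<in> compactly_supported T" "g' \<in> compactly_supported T" "x \<in> carrier G"
  shows "conv_left G \<nu> a g x - conv_left G \<nu> a' g' x =
    conv_left G \<nu> (\<lambda>h. a h - a' h) g x + conv_left G \<nu> a' (\<lambda>x. g x - g' x) x"
proof -
  note i = conv_integrable[OF assms(1,3,5)] conv_integrable[OF assms(2,3,5)]
    conv_integrable[OF assms(2,4,5)]
  show ?thesis using i by (simp add: conv_left_def left_diff_distrib right_diff_distrib)
qed

lemma L1_module_image:
  fixes B :: "'d::cstar_algebra \<Rightarrow> 'c::cstar_algebra \<Rightarrow> 'c"
  assumes B: "bounded_bilinear B"
    and \<iota>H: "L1_star_hom H' \<nu> \<iota>H" and \<iota>G: "L1_star_hom G \<mu> \<iota>G"
    and conv: "\<And>a g. a \<in> compactly_supported (subtopology T H) \<Longrightarrow> g \<in> compactly_supported T \<Longrightarrow>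
      B (\<iota>H a) (\<iota>G g) = \<iota>G (conv_left G \<nu> a g)"
    and a: "a \<in> L1 \<nu>" and g: "g \<in> L1 \<mu>"
  shows "B (\<iota>H a) (\<iota>G g) \<in> \<iota>G ` L1 \<mu>"
proof -
  let ?A = "(\<integral>h. norm (a h) \<partial>\<nu>) + 1" and ?B = "(\<integral>x. norm (g x) \<partial>\<mu>) + 1"
  obtain a' where a': "\<And>n. a' n \<in> compactly_supported (subtopology T H)"
    "(\<lambda>n. \<integral>h. norm (a' n h - a h) \<partial>\<nu>) \<longlonglongrightarrow> 0"
    "\<And>n. (\<integral>h. norm (a' (Suc n) h - a' n h) \<partial>\<nu>) \<le> 2 * (1/2)^n"
    "\<And>n. (\<integral>h. norm (a' n h) \<partial>\<nu>) \<le> ?A"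
    using H.compactly_supported_fast_approx[OF a] by blast
  obtain g' where g': "\<And>n. g' n \<in> compactly_supported T"
    "(\<lambda>n. \<integral>x. norm (g' n x - g x) \<partial>\<mu>) \<longlonglongrightarrow> 0"
    "\<And>n. (\<integral>x. norm (g' (Suc n) x - g' n x) \<partial>\<mu>) \<le> 2 * (1/2)^n"
    "\<And>n. (\<integral>x. norm (g' n x) \<partial>\<mu>) \<le> ?B"
    using G.compactly_supported_fast_approx[OF g] by blast
  define c where "c n = conv_left G \<nu> (a' n) (g' n)" for n
  have c: "integrable \<mu> (c n)" for n
    unfolding c_def using integrable_conv_left[OF a'(1) g'(1)] .
  have step: "(\<integral>x. norm (c (Suc n) x - c n x) \<partial>\<mu>) \<le> (2 * ?B + ?A * 2) * (1/2)^n" for n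
  proof -
    define u where "u = conv_left G \<nu> (\<lambda>h. a' (Suc n) h - a' n h) (g' (Suc n))"
    define v where "v = conv_left G \<nu> (a' n) (\<lambda>x. g' (Suc n) x - g' n x)"
    have da: "(\<lambda>h. a' (Suc n) h - a' n h) \<in> compactly_supported (subtopology T H)"
      and dg: "(\<lambda>x. g' (Suc n) x - g' n x) \<in> compactly_supported T"
      using H.compactly_supported_diff[OF a'(1) a'(1)] G.compactly_supported_diff[OF g'(1) g'(1)] by auto
    have u: "integrable \<mu> u" "(\<integral>x. norm (u x) \<partial>\<mu>) \<le> 2 * (1/2)^n * ?B"
      unfolding u_def using integrable_conv_left[OF da g'(1)]
        order_trans[OF norm_conv_left[OF da g'(1)] mult_mono[OF a'(3) g'(4)]] by auto
    have v: "integrable \<mu> v" "(\<integral>x. norm (v x) \<partial>\<mu>) \<le> ?A * (2 * (1/2)^n)"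
      unfolding v_def using integrable_conv_left[OF a'(1) dg]
        order_trans[OF norm_conv_left[OF a'(1) dg] mult_mono[OF a'(4) g'(3)]] by auto
    have "(\<integral>x. norm (c (Suc n) x - c n x) \<partial>\<mu>) \<le> (\<integral>x. norm (u x) + norm (v x) \<partial>\<mu>)"
    proof (rule integral_mono)
      fix x assume "x \<in> space \<mu>"
      then have "x \<in> carrier G" by (simp add: G.space_eq topspace_eq)
      then have "c (Suc n) x - c n x = u x + v x"
        unfolding c_def u_def v_def using a'(1) g'(1) by (intro conv_left_diff)
      then show "norm (c (Suc n) x - c n x) \<le> norm (u x) + norm (v x)"
        by (simp add: norm_triangle_ineq)
    qed (use c u v in auto)
    also have "\<dots> = (\<integral>x. norm (u x) \<partial>\<mu>) + (\<integral>x. norm (v x) \<partial>\<mu>)"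
      using u v by (intro Bochner_Integration.integral_add) auto
    also have "\<dots> \<le> 2 * (1/2)^n * ?B + ?A * (2 * (1/2)^n)" using u v by simp
    also have "\<dots> = (2 * ?B + ?A * 2) * (1/2)^n" by (simp add: algebra_simps)
    finally show ?thesis .
  qed
  have "summable (\<lambda>n. \<integral>x. norm (c (Suc n) x - c n x) \<partial>\<mu>)"
  proof (rule summable_comparison_test')
    show "summable (\<lambda>n. (2 * ?B + ?A * 2) * (1/2)^n)"
      by (intro summable_mult summable_geometric) simp
    show "norm (\<integral>x. norm (c (Suc n) x - c n x) \<partial>\<mu>) \<le> (2 * ?B + ?A * 2) * (1/2)^n" if "n \<ge> 0" for n
      using step[of n] by simp
  qed
  then obtain F where F: "integrable \<mu> F" "(\<lambda>n. \<integral>x. norm (c n x - F x) \<partial>\<mu>) \<longlonglongrightarrow> 0"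
    using L1_fast_cauchy_limit[of \<mu> c] c by blast
  have "(\<lambda>n. \<iota>G (c n)) \<longlonglongrightarrow> \<iota>G F"
    using L1_star_hom_tendsto[OF \<iota>G _ _ F(2)] c F(1) by (simp add: L1_def)
  moreover have "(\<lambda>n. \<iota>G (c n)) \<longlonglongrightarrow> B (\<iota>H a) (\<iota>G g)"
  proof -
    have "(\<lambda>n. \<iota>H (a' n)) \<longlonglongrightarrow> \<iota>H a"
      using L1_star_hom_tendsto[OF \<iota>H _ a a'(2)] H.compactly_supported_integrable[OF a'(1)]
      by (simp add: L1_def)
    moreover have "(\<lambda>n. \<iota>G (g' n)) \<longlonglongrightarrow> \<iota>G g"
      using L1_star_hom_tendsto[OF \<iota>G _ g g'(2)] G.compactly_supported_integrable[OF g'(1)]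
      by (simp add: L1_def)
    ultimately have "(\<lambda>n. B (\<iota>H (a' n)) (\<iota>G (g' n))) \<longlonglongrightarrow> B (\<iota>H a) (\<iota>G g)"
      by (rule bounded_bilinear.tendsto[OF B])
    then show ?thesis using conv[OF a'(1) g'(1)] by (simp add: c_def)
  qed
  ultimately have "B (\<iota>H a) (\<iota>G g) = \<iota>G F" by (rule LIMSEQ_unique[symmetric])
  then show ?thesis using F(1) by (auto simp: L1_def)
qed

end

section \<open>Induction and restriction of ideals\<close>

lemma multiplier_action_bounded_bilinear:
  assumes "multiplier_action L R"
  shows "bounded_bilinear L"
proof
  have lin: "Vector_Spaces.linear scaleC scaleC (L b)" for b
    using assms by (simp add: multiplier_action_def double_centralizer_def)
  show "L (a + a') b = L a b + L a' b" for a a' b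
    using assms by (simp add: multiplier_action_def)
  show "L a (b + b') = L a b + L a b'" for a b b'
    using lin[of a] by (simp add: Vector_Spaces.linear_def module_hom_def module_hom_axioms_def)
  show "L (r *\<^sub>R a) b = r *\<^sub>R L a b" for r a b
    using assms by (simp add: multiplier_action_def flip: scaleC_of_real)
  show "L a (r *\<^sub>R b) = r *\<^sub>R L a b" for r a b
    using lin[of a]
    by (simp add: Vector_Spaces.linear_def module_hom_def module_hom_axioms_def flip: scaleC_of_real)
  show "\<exists>K. \<forall>a b. norm (L a b) \<le> norm a * norm b * K"
    using assms by (intro exI[of _ 1]) (simp add: multiplier_action_def)
qed

text \<open>
  The restriction of an ideal \<open>K\<close> to the acting algebra, which is right adjoint to induction.
  Testing with products on both sides makes this an ideal without approximate units.
\<close>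
definition restricted_ideal ::
    "('d::cstar_algebra \<Rightarrow> 'c::cstar_algebra \<Rightarrow> 'c) \<Rightarrow> 'c set \<Rightarrow> 'd set" where
  "restricted_ideal L K = {b. \<forall>x y. x * L b y \<in> K}"

lemma closed_ideal_restricted_ideal:
  assumes act: "multiplier_action L R" and K: "closed_ideal K"
  shows "closed_ideal (restricted_ideal L K)"
proof -
  interpret L: bounded_bilinear L using multiplier_action_bounded_bilinear[OF act] .
  have Ks: "csubspace K" and Kc: "closed K" using K by (auto simp: closed_ideal_def)
  have "closed {b. x * L b y \<in> K}" for x y
  proof -
    have "closed ((\<lambda>b. x * L b y) -` K)"
      using Kc by (intro continuous_closed_vimage)
        (auto intro!: continuous_mult continuous_const L.continuous continuous_ident)
    then show ?thesis by (simp add: vimage_def)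
  qed
  then have "closed (restricted_ideal L K)"
    unfolding restricted_ideal_def by (intro closed_Collect_all)
  moreover have "csubspace (restricted_ideal L K)"
  proof (rule complex_vector.subspaceI)
    show "0 \<in> restricted_ideal L K"
      using complex_vector.subspace_0[OF Ks] by (simp add: restricted_ideal_def L.zero_left)
    show "a + b \<in> restricted_ideal L K" if "a \<in> restricted_ideal L K" "b \<in> restricted_ideal L K" for a b
      using that complex_vector.subspace_add[OF Ks]
      by (simp add: restricted_ideal_def L.add_left distrib_left)
    show "scaleC c a \<in> restricted_ideal L K" if "a \<in> restricted_ideal L K" for c a
      using that act complex_vector.subspace_scale[OF Ks]
      by (simp add: restricted_ideal_def multiplier_action_def mult_scaleC_right)
  qed
  moreover have "a * b \<in> restricted_ideal L K \<and> b * a \<in> restricted_ideal L K"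
    if b: "b \<in> restricted_ideal L K" for a b
  proof -
    have "x * L (a * b) y = R a x * L b y" "x * L (b * a) y = x * L b (L a y)" for x y
      using act by (simp_all add: multiplier_action_def double_centralizer_def)
    then show ?thesis using b by (simp add: restricted_ideal_def)
  qed
  ultimately show ?thesis unfolding closed_ideal_def by blast
qed

lemma induced_ideal_subset_iff:
  assumes "closed_ideal K"
  shows "induced_ideal L J \<subseteq> K \<longleftrightarrow> J \<subseteq> restricted_ideal L K"
proof
  assume "induced_ideal L J \<subseteq> K"
  moreover have "x * L j y \<in> induced_ideal L J" if "j \<in> J" for x j y
    unfolding induced_ideal_def
    using that by (intro subsetD[OF closure_subset] complex_vector.span_base) blast
  ultimately show "J \<subseteq> restricted_ideal L K" unfolding restricted_ideal_def by blast
next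
  assume "J \<subseteq> restricted_ideal L K"
  then show "induced_ideal L J \<subseteq> K"
    using assms unfolding induced_ideal_def closed_ideal_def restricted_ideal_def
    by (intro closure_minimal complex_vector.span_minimal) auto
qed

theorem proposition2p12:
  fixes G :: "('a, 'm) monoid_scheme" and T :: "'a topology" and H :: "'a set"
    and \<mu> \<nu> :: "'a measure"
    and \<iota>G :: "('a \<Rightarrow> complex) \<Rightarrow> 'c::cstar_algebra"
    and \<iota>H :: "('a \<Rightarrow> complex) \<Rightarrow> 'd::cstar_algebra"
    and L R :: "'d \<Rightarrow> 'c \<Rightarrow> 'c"
    and I :: "'c set"
  assumes "locally_compact_group G T"
    and "subgroup H G" and "closedin T H"
    and "left_haar_measure G T \<mu>"
    and "left_haar_measure (G\<lparr>carrier := H\<rparr>) (subtopology T H) \<nu>"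
    and "enveloping_cstar G \<mu> \<iota>G"
    and "enveloping_cstar (G\<lparr>carrier := H\<rparr>) \<nu> \<iota>H"
    and "convolution_action G T \<mu> H \<nu> \<iota>G \<iota>H L R"
    and "star_regular \<nu> \<iota>H"
    and "closed_ideal I"
    and "is_induced L I"
  shows "L1_determined \<mu> \<iota>G I"
  unfolding L1_determined_def
proof (intro allI impI)
  fix K assume K: "closed_ideal K" and IK: "I \<inter> \<iota>G ` L1 \<mu> \<subseteq> K \<inter> \<iota>G ` L1 \<mu>"
  obtain J where J: "closed_ideal J" and I: "I = induced_ideal L J"
    using assms(11) by (auto simp: is_induced_def)
  interpret T: locally_compact_group G T by fact
  have \<mu>: "radon_space T \<mu>"
    using radon_space_haar[OF assms(4) T.hausdorff T.locally_compact] .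
  have \<nu>: "radon_space (subtopology T H) \<nu>"
    using radon_space_haar[OF assms(5)] T.hausdorff T.locally_compact assms(3)
    by (simp add: Hausdorff_space_subtopology locally_compact_space_closed_subset)
  have inv: "emeasure \<mu> (h <#\<^bsub>G\<^esub> A) = emeasure \<mu> A" if "h \<in> carrier G" "A \<in> sets \<mu>" for h A
    using assms(4) that by (simp add: left_haar_measure_def)
  have GH: "haar_convolution G T \<mu> H \<nu>"
    using assms(1) \<mu> \<nu> subgroup.subset[OF assms(2)] inv
    by (simp add: haar_convolution_def haar_convolution_axioms_def)
  have T_carrier: "subtopology T (carrier G) = T"
    using subtopology_topspace[of T] by (simp add: T.topspace_eq)
  have GG: "haar_convolution G T \<mu> (carrier G) \<mu>"
    using assms(1) \<mu> inv T_carrier by (simp add: haar_convolution_def haar_convolution_axioms_def)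
  have act: "multiplier_action L R"
    and conv: "\<And>a f. a \<in> compactly_supported (subtopology T H) \<Longrightarrow> f \<in> compactly_supported T \<Longrightarrow>
      L (\<iota>H a) (\<iota>G f) = \<iota>G (conv_left G \<nu> a f)"
    using assms(8) by (auto simp: convolution_action_def)
  interpret L: bounded_bilinear L using multiplier_action_bounded_bilinear[OF act] .
  have \<iota>G: "L1_star_hom G \<mu> \<iota>G" and dense: "closure (\<iota>G ` L1 \<mu>) = UNIV"
    using assms(6) by (auto simp: enveloping_cstar_def)
  have \<iota>H: "L1_star_hom (G\<lparr>carrier := H\<rparr>) \<nu> \<iota>H"
    using assms(7) by (auto simp: enveloping_cstar_def)
  have conv': "\<iota>G a * \<iota>G f = \<iota>G (conv_left G \<mu> a f)"
    if "a \<in> compactly_supported (subtopology T (carrier G))" "f \<in> compactly_supported T" for a f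
  proof -
    have "a \<in> L1 \<mu>" "f \<in> L1 \<mu>"
      using that radon_space.compactly_supported_integrable[OF \<mu>] by (auto simp: T_carrier L1_def)
    then have "\<iota>G (L1_conv G \<mu> a f) = \<iota>G a * \<iota>G f" using \<iota>G by (simp add: L1_star_hom_def)
    moreover have "L1_conv G \<mu> a f = conv_left G \<mu> a f" by (simp add: fun_eq_iff L1_conv_def conv_left_def)
    ultimately show ?thesis by simp
  qed
  have Kc: "closed K" using K by (simp add: closed_ideal_def)
  have "\<iota>H a \<in> restricted_ideal L K" if a: "a \<in> L1 \<nu>" "\<iota>H a \<in> J" for a
  proof -
    have 0: "\<iota>G f * L (\<iota>H a) (\<iota>G g) \<in> K" if f: "f \<in> L1 \<mu>" and g: "g \<in> L1 \<mu>" for f g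
    proof -
      have "L (\<iota>H a) (\<iota>G g) \<in> \<iota>G ` L1 \<mu>"
        using haar_convolution.L1_module_image[OF GH L.bounded_bilinear_axioms \<iota>H \<iota>G conv a(1) g] .
      then have "\<iota>G f * L (\<iota>H a) (\<iota>G g) \<in> \<iota>G ` L1 \<mu>"
        using haar_convolution.L1_module_image[OF GG bounded_bilinear_mult \<iota>G \<iota>G conv' f] by auto
      moreover have "\<iota>G f * L (\<iota>H a) (\<iota>G g) \<in> I"
        using induced_ideal_subset_iff[OF assms(10), of L J] I a(2) by (auto simp: restricted_ideal_def)
      ultimately show ?thesis using IK by blast
    qed
    have 1: "\<iota>G f * L (\<iota>H a) y \<in> K" if f: "f \<in> L1 \<mu>" for f y
    proof -
      have "closed ((\<lambda>y. \<iota>G f * L (\<iota>H a) y) -` K)"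
        using Kc by (intro continuous_closed_vimage)
          (auto intro!: continuous_mult continuous_const L.continuous continuous_ident)
      then have "closure (\<iota>G ` L1 \<mu>) \<subseteq> (\<lambda>y. \<iota>G f * L (\<iota>H a) y) -` K"
        using 0[OF f] by (intro closure_minimal) auto
      then show ?thesis unfolding dense by auto
    qed
    have "x * L (\<iota>H a) y \<in> K" for x y
    proof -
      have "closed ((\<lambda>x. x * L (\<iota>H a) y) -` K)"
        using Kc by (intro continuous_closed_vimage)
          (auto intro!: continuous_mult continuous_const continuous_ident)
      then have "closure (\<iota>G ` L1 \<mu>) \<subseteq> (\<lambda>x. x * L (\<iota>H a) y) -` K"
        using 1 by (intro closure_minimal) auto
      then show ?thesis unfolding dense by auto
    qed
    then show ?thesis by (simp add: restricted_ideal_def)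
  qed
  then have "J \<inter> \<iota>H ` L1 \<nu> \<subseteq> restricted_ideal L K \<inter> \<iota>H ` L1 \<nu>" by blast
  then have "J \<subseteq> restricted_ideal L K"
    using assms(9) J closed_ideal_restricted_ideal[OF act K]
    unfolding star_regular_def L1_determined_def by blast
  then show "I \<subseteq> K" unfolding I induced_ideal_subset_iff[OF K] .
qed

end
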